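(* There exists an infinite set $W=\{w_1<w_2<\cdots\}\subseteq\mathbb{N}$ that is not eventually periodic, such that $w_{i+1}-w_i\in\{1,2\}$ for all $i\ge 1$ and there exists a minimal complement to $W$.
   Context: $\mathbb{N}$ is the set of nonnegative integers, $\mathbb{Z}$ the set of integers. For $A,B\subseteq\mathbb{Z}$, $A+B=\{a+b: a\in A, b\in B\}$. A set $A\subseteq\mathbb{Z}$ is a complement to $B\subseteq\mathbb{Z}$ (in $\mathbb{Z}$) if $A+B=\mathbb{Z}$; it is a minimal complement to $B$ if in addition no proper subset of $A$ is a complement to $B$. A set $X\subseteq\mathbb{N}$ is eventually periodic if there exists a positive integer $T$ such that $x+T\in X$ for all sufficiently large integers $x\in X$. *)

theory Defs
  imports Complex_Main "HOL-Library.Infinite_Set" "HOL-Library.Set_Algebras"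
begin

(* Here + on sets is the Minkowski sum of Set_Algebras. *)
definition complement_to :: "int set \<Rightarrow> int set \<Rightarrow> bool" where
  "complement_to A B \<longleftrightarrow> A + B = UNIV"

definition minimal_complement_to :: "int set \<Rightarrow> int set \<Rightarrow> bool" where
  "minimal_complement_to A B \<longleftrightarrow>
     complement_to A B \<and> (\<forall>A'. A' \<subset> A \<longrightarrow> \<not> complement_to A' B)"

definition eventually_periodic :: "nat set \<Rightarrow> bool" where
  "eventually_periodic X \<longleftrightarrow> (\<exists>T>0. \<exists>N. \<forall>x\<in>X. x \<ge> N \<longrightarrow> x + T \<in> X)"

end

theory Submission
  imports Defs
begin

text \<open>
  The set \<open>W\<close> is built by prescribing its gaps. An element \<open>m\<close> of a complement \<open>M\<close> cannot be removed
  as soon as some integer \<open>z\<close> satisfies \<open>z - m' \<notin> W\<close> for every other \<open>m' \<in> M\<close>. With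
  \<open>M = {- a j | j}\<close> and witness \<open>4 * a k\<close> for \<open>- a k\<close>, this asks precisely that the sums
  \<open>4 * a k + a j\<close> with \<open>j \<noteq> k\<close> be gaps of \<open>W\<close>, so \<open>W\<close> is the set of all other naturals.

  For the lacunary sequence \<open>a j = 2 * 16 ^ j\<close> these gaps do not interfere with the remaining
  requirements. They are all even, so no two are adjacent and consecutive elements of \<open>W\<close> differ by
  \<open>1\<close> or \<open>2\<close>. A sum \<open>4 * a k + a j\<close> determines \<open>k\<close> and \<open>j\<close>, so \<open>4 * a k + a k\<close> is in \<open>W\<close> and
  \<open>4 * a k\<close> is still covered. Finally, if \<open>a j\<close> is large compared with \<open>z\<close>, then \<open>z + a j\<close> can be a
  gap only when \<open>z\<close> is itself a witness (\<open>gap_near_scale\<close>). Hence every integer that is not a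
  witness is covered by all sufficiently negative elements of \<open>M\<close>. The same lemma rules out eventual
  periodicity: for a fixed witness \<open>4 * a k > 2 * T\<close>, the points \<open>4 * a k + a j\<close> are gaps for all
  \<open>j > k\<close>, whereas \<open>4 * a k - T + a j\<close> is in \<open>W\<close> for all large \<open>j\<close>.
\<close>

definition scale :: "nat \<Rightarrow> nat" where
  "scale j = 2 * 16 ^ j"

definition gaps :: "nat set" where
  "gaps = {4 * scale k + scale j | j k. j \<noteq> k}"

lemma scale_pos: "0 < scale j"
  by (simp add: scale_def)

lemma scale_lacunary:
  assumes "i < j"
  shows "16 * scale i \<le> scale j"
proof -
  have "(16::nat) ^ Suc i \<le> 16 ^ j"
    using assms by (intro power_increasing) auto
  thus ?thesis by (simp add: scale_def)
qed

lemma scale_unbounded: "n < scale n"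
proof -
  have "n < 16 ^ n" by (rule less_exp[THEN order.strict_trans2]) (simp add: power_mono)
  thus ?thesis by (simp add: scale_def)
qed

lemma scale_mono:
  assumes "i \<le> j"
  shows "scale i \<le> scale j"
  using assms by (simp add: scale_def)

lemma even_gap: "g \<in> gaps \<Longrightarrow> even g"
  by (auto simp: gaps_def scale_def)

text \<open>
  In base \<open>16\<close>, half of a gap has one digit \<open>4\<close> and one digit \<open>1\<close> in different places, whereas half
  of \<open>4 * scale k + scale k\<close> has the single digit \<open>5\<close>. The proof compares sizes instead.
\<close>

lemma diagonal_sum_not_gap: "4 * scale k + scale k \<notin> gaps"
proof
  assume "4 * scale k + scale k \<in> gaps"
  then obtain i l where ne: "i \<noteq> l"
    and eq: "4 * scale k + scale k = 4 * scale l + scale i"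
    by (auto simp: gaps_def)
  have "l \<le> k" using scale_lacunary[of k l] eq scale_pos[of k] by linarith
  moreover have "i \<le> k" using scale_lacunary[of k i] eq scale_pos[of k] by linarith
  ultimately consider "l < k" | "l = k" "i < k" using ne by linarith
  thus False
  proof cases
    case 1
    thus False
      using scale_lacunary[of l k] scale_mono[OF \<open>i \<le> k\<close>] eq scale_pos[of k] by linarith
  next
    case 2
    thus False using scale_lacunary[of i k] eq scale_pos[of k] by simp
  qed
qed

text \<open>
  Write \<open>z + scale j\<close> as \<open>4 * scale k + scale i\<close>. The left-hand side lies strictly between half
  and three halves of \<open>scale j\<close>. By lacunarity the right-hand side is at least \<open>4 * scale j\<close> if
  \<open>k \<ge> j\<close> or \<open>i > j\<close>, and at most \<open>5 / 16\<close> of \<open>scale j\<close> if \<open>k < j\<close> and \<open>i < j\<close>. This leaves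
  \<open>i = j\<close>, where the two terms cancel.
\<close>

lemma gap_near_scale:
  fixes z :: int
  assumes gap: "z + int (scale j) = int g" "g \<in> gaps"
    and small: "2 * \<bar>z\<bar> < int (scale j)"
  obtains k where "z = 4 * int (scale k)"
proof -
  obtain i k where "i \<noteq> k" and g: "g = 4 * scale k + scale i"
    using gap(2) by (auto simp: gaps_def)
  have eq: "z + int (scale j) = 4 * int (scale k) + int (scale i)"
    using gap(1) g by simp
  have "k < j"
    using scale_mono[of j k] eq small scale_pos[of i] by linarith
  hence k: "16 * scale k \<le> scale j" by (rule scale_lacunary)
  have "\<not> j < i"
    using scale_lacunary[of j i] eq small by linarith
  moreover have "\<not> i < j"
    using scale_lacunary[of i j] k eq small by linarith
  ultimately have "i = j" by simp
  thus thesis using eq by (intro that[of k]) simp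
qed

lemma infinite_non_gaps: "infinite (- gaps)"
proof
  assume "finite (- gaps)"
  moreover have "(\<lambda>n. 2 * n + 1) ` UNIV \<subseteq> - gaps"
    using even_gap by fastforce
  ultimately have "finite (range (\<lambda>n::nat. 2 * n + 1))"
    by (rule rev_finite_subset)
  thus False by (subst (asm) finite_image_iff) (auto simp: inj_on_def)
qed

lemma enumerate_diff_1_or_2:
  fixes W :: "nat set"
  assumes inf: "infinite W" and step: "\<And>n. n + 1 \<in> W \<or> n + 2 \<in> W"
  shows "enumerate W (Suc i) - enumerate W i \<in> {1, 2}"
proof -
  let ?e = "enumerate W i"
  have "enumerate W (Suc i) = (LEAST s. s \<in> W \<and> ?e < s)"
    by (rule enumerate_Suc''[OF inf])
  moreover have "(LEAST s. s \<in> W \<and> ?e < s) \<le> ?e + 2"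
    using step[of ?e]
  proof
    assume "?e + 1 \<in> W"
    hence "(LEAST s. s \<in> W \<and> ?e < s) \<le> ?e + 1" by (intro Least_le) simp
    thus ?thesis by simp
  next
    assume "?e + 2 \<in> W"
    thus ?thesis by (intro Least_le) simp
  qed
  moreover have "?e < enumerate W (Suc i)"
    by (rule enumerate_step[OF inf])
  ultimately show ?thesis by auto
qed

lemma non_gaps_not_eventually_periodic: "\<not> eventually_periodic (- gaps)"
proof
  assume "eventually_periodic (- gaps)"
  then obtain T N where "T > 0"
    and per: "\<And>x. x \<notin> gaps \<Longrightarrow> N \<le> x \<Longrightarrow> x + T \<notin> gaps"
    by (auto simp: eventually_periodic_def)
  obtain k where Tk: "T < scale k" using scale_unbounded by blast
  \<comment> \<open>This choice puts \<open>scale j\<close> above \<open>N\<close> and above twice the point \<open>4 * scale k - T\<close>.\<close>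
  define j where "j = N + 8 * scale k"
  have j: "N + 8 * scale k < scale j" unfolding j_def by (rule scale_unbounded)
  have "j \<noteq> k" using j scale_pos[of k] by auto
  hence "4 * scale k + scale j \<in> gaps" by (auto simp: gaps_def)
  moreover define x where "x = 4 * scale k + scale j - T"
  have x: "x + T = 4 * scale k + scale j" "N \<le> x"
    using Tk j by (simp_all add: x_def)
  ultimately have "x \<in> gaps" using per[of x] by auto
  moreover have "(4 * int (scale k) - int T) + int (scale j) = int x"
    using x(1) by linarith
  ultimately obtain l where l: "4 * int (scale k) - int T = 4 * int (scale l)"
    using gap_near_scale[of "4 * int (scale k) - int T" j x] Tk j by auto
  \<comment> \<open>This is impossible, since \<open>4 * scale k - T\<close> is more than half of the witness \<open>4 * scale k\<close>
    and smaller witnesses are at most a sixteenth of it.\<close>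
  have "l < k" using scale_mono[of k l] l \<open>T > 0\<close> by linarith
  thus False using scale_lacunary[of l k] l Tk by linarith
qed

lemma complement_non_gaps:
  "complement_to (range (\<lambda>j. - int (scale j))) (int ` (- gaps))"
proof -
  have "z \<in> range (\<lambda>j. - int (scale j)) + int ` (- gaps)" for z
  proof -
    have "\<exists>j w. w \<notin> gaps \<and> z + int (scale j) = int w"
    proof (cases "\<exists>k. z = 4 * int (scale k)")
      case True
      then obtain k where k: "z = 4 * int (scale k)" by blast
      have "z + int (scale k) = int (4 * scale k + scale k)" using k by simp
      thus ?thesis using diagonal_sum_not_gap by blast
    next
      case False
      define j where "j = nat (2 * \<bar>z\<bar>)"
      have small: "2 * \<bar>z\<bar> < int (scale j)"
        using scale_unbounded[of j] by (simp add: j_def)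
      hence "0 \<le> z + int (scale j)" by linarith
      then obtain w where w: "z + int (scale j) = int w" by (rule nonneg_int_cases)
      have "w \<notin> gaps"
        using gap_near_scale[OF w _ small] False by blast
      thus ?thesis using w by blast
    qed
    then obtain j w where "w \<notin> gaps" "z + int (scale j) = int w" by blast
    hence "- int (scale j) + int w \<in> range (\<lambda>j. - int (scale j)) + int ` (- gaps)"
      by (intro set_plus_intro) auto
    moreover have "- int (scale j) + int w = z"
      using \<open>z + int (scale j) = int w\<close> by linarith
    ultimately show ?thesis by simp
  qed
  thus ?thesis unfolding complement_to_def by blast
qed

text \<open>If \<open>- scale k\<close> is removed, the witness \<open>4 * scale k\<close> is no longer covered.\<close>

lemma minimal_complement_non_gaps:
  "minimal_complement_to (range (\<lambda>j. - int (scale j))) (int ` (- gaps))"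
  unfolding minimal_complement_to_def
proof (intro conjI allI impI notI)
  show "complement_to (range (\<lambda>j. - int (scale j))) (int ` (- gaps))"
    by (rule complement_non_gaps)
next
  fix A
  assume A: "A \<subset> range (\<lambda>j. - int (scale j))" and "complement_to A (int ` (- gaps))"
  from A obtain k where k: "- int (scale k) \<notin> A" by blast
  have "4 * int (scale k) \<in> A + int ` (- gaps)"
    using \<open>complement_to A _\<close> by (simp add: complement_to_def)
  then obtain m w where "m \<in> A" and w: "w \<notin> gaps" and m: "4 * int (scale k) = m + int w"
    by (auto elim!: set_plus_elim)
  then obtain j where j: "m = - int (scale j)" using A by blast
  have eq: "4 * int (scale k) = - int (scale j) + int w" using m j by simp
  have "j \<noteq> k" using k j \<open>m \<in> A\<close> by auto
  moreover have "w = 4 * scale k + scale j" using eq by linarith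
  ultimately show False using w by (auto simp: gaps_def)
qed

theorem theorem4:
  shows "\<exists>W :: nat set. infinite W \<and> \<not> eventually_periodic W \<and>
           (\<forall>i. enumerate W (Suc i) - enumerate W i \<in> {1, 2}) \<and>
           (\<exists>M. minimal_complement_to M (int ` W))"
proof (intro exI[of _ "- gaps"] conjI allI)
  have "n + 1 \<in> - gaps \<or> n + 2 \<in> - gaps" for n
    using even_gap[of "n + 1"] even_gap[of "n + 2"] by auto
  thus "enumerate (- gaps) (Suc i) - enumerate (- gaps) i \<in> {1, 2}" for i
    by (rule enumerate_diff_1_or_2[OF infinite_non_gaps])
  show "\<exists>M. minimal_complement_to M (int ` (- gaps))"
    using minimal_complement_non_gaps by blast
qed (fact infinite_non_gaps non_gaps_not_eventually_periodic)+

end
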